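(* Let $m\ge 1$ be an integer. 1. For $N=2m$: $$\Phi^{2m}_{m-1\,1}=C_m,\qquad \Phi^{2m}_{m+1\,1}=-C_m,\qquad \Phi^{2m}_{m\,2}=-2C_{m-1}.$$ 2. For $N=2m+1$: $$\Phi^{2m+1}_{m\,1}=C_m,\qquad \Phi^{2m+1}_{m\,2}=\Phi^{2m+1}_{m+1\,1}=\Phi^{2m+1}_{m+1\,2}=-C_m .$$ 3. The corresponding entries read from right to left along the rows are obtained from the sign symmetry $\Phi^{N}_{i\,N-j}=(-1)^i\,\Phi^{N}_{i\,j}$, namely $$\Phi^{2m}_{m-1\;2m-1}=(-1)^{m-1}C_m,\quad \Phi^{2m}_{m+1\;2m-1}=(-1)^{m}C_m,\quad \Phi^{2m}_{m\;2m-2}=(-1)^{m+1}\,2C_{m-1},$$ $$\Phi^{2m+1}_{m\;2m}=(-1)^mC_m,\quad \Phi^{2m+1}_{m\;2m-1}=(-1)^{m+1}C_m,\quad \Phi^{2m+1}_{m+1\;2m}=\Phi^{2m+1}_{m+1\;2m-1}=(-1)^{m}C_m .$$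
   Context: For an integer $N\ge 0$ and an integer $0\le j\le N$, the symmetric Krawtchouk values $\Phi^{N}_{n\,j}$ ($n$ = row index, $j$ = column index, both starting at $0$) are defined by $$(1+z)^{N-j}(1-z)^j=\sum_{n=0}^N z^n\,\Phi^{N}_{n\,j}.$$ $C_m=\frac{1}{m+1}\binom{2m}{m}$ is the $m$-th Catalan number. *)

theory Defs
  imports Complex_Main "HOL-Computational_Algebra.Polynomial"
begin

text \<open>\<open>Phi N n j\<close> has row index \<open>n\<close> and column index \<open>j\<close>, both starting at 0. It is meant for
  \<open>j \<le> N\<close>; for \<open>j > N\<close> the truncated subtraction \<open>N - j\<close> gives values without meaning.\<close>

definition Phi :: "nat \<Rightarrow> nat \<Rightarrow> nat \<Rightarrow> int" where
  "Phi N n j = coeff ([:1, 1:] ^ (N - j) * [:1, - 1:] ^ j) n"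

lemma Phi_generating_function:
  fixes z :: int
  assumes "j \<le> N"
  shows "(1 + z) ^ (N - j) * (1 - z) ^ j = (\<Sum>n = 0..N. z ^ n * Phi N n j)"
proof -
  let ?p = "[:1, 1:] ^ (N - j) * [:1, - 1:] ^ j :: int poly"
  have "degree ?p = N"
    using assms by (simp add: degree_mult_eq degree_power_eq)
  then have "poly ?p z = (\<Sum>n\<le>N. coeff ?p n * z ^ n)"
    by (simp add: poly_altdef)
  moreover have "poly ?p z = (1 + z) ^ (N - j) * (1 - z) ^ j"
    by simp
  ultimately show ?thesis
    by (simp add: Phi_def atLeast0AtMost mult.commute)
qed

definition catalan :: "nat \<Rightarrow> real" where
  "catalan m = 1 / (real m + 1) * real ((2 * m) choose m)"

end

theory Submission imports Defs begin

text \<open>The two Pascal-type recurrences (multiplication by \<open>1 + z\<close> and \<open>1 - z\<close>) and the substitutions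
  \<open>z \<mapsto> 1/z\<close> and \<open>z \<mapsto> -z\<close> reduce every entry to
  \<open>Phi (2m + 1) (m + 1) 1 = binom (2m) (m + 1) - binom (2m) m = - C\<^sub>m\<close>. In particular the reflection
  forces \<open>Phi (2m) m 1 = 0\<close>, so the neighbours of this entry are determined.\<close>

lemma Phi_0_right: "Phi N n 0 = int (N choose n)"
  by (cases "n \<le> N")
    (simp_all add: Phi_def coeff_linear_poly_power coeff_eq_0 degree_power_eq)

lemma Phi_Suc:
  assumes "j \<le> N"
  shows "Phi (Suc N) (Suc n) j = Phi N (Suc n) j + Phi N n j"
proof -
  \<comment> \<open>The bound on \<open>j\<close> gives \<open>Suc N - j = Suc (N - j)\<close>; with
    truncation, no factor 1 + z would split off.\<close>
  have "[:1, 1:] ^ (Suc N - j) * [:1, - 1:] ^ j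
      = [:1, 1:] * ([:1, 1:] ^ (N - j) * [:1, - 1:] ^ j :: int poly)"
    using assms by (simp only: Suc_diff_le power_Suc mult.assoc)
  then show ?thesis
    by (simp add: Phi_def)
qed

lemma Phi_Suc_Suc: "Phi (Suc N) (Suc n) (Suc j) = Phi N (Suc n) j - Phi N n j"
proof -
  have "[:1, 1:] ^ (Suc N - Suc j) * [:1, - 1:] ^ Suc j
      = [:1, - 1:] * ([:1, 1:] ^ (N - j) * [:1, - 1:] ^ j :: int poly)"
    by (simp only: diff_Suc_Suc power_Suc mult.left_commute)
  then show ?thesis
    by (simp add: Phi_def)
qed

text \<open>Reversing coefficients fixes 1 + z and turns 1 - z into z - 1, so each of the
  \<open>j\<close> factors contributes a sign. \<open>reflect_poly\<close> reverses about the actual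
  degree, which must therefore be exactly \<open>N\<close>.\<close>

lemma Phi_reflect_row:
  assumes "n \<le> N" "j \<le> N"
  shows "Phi N (N - n) j = (- 1) ^ j * Phi N n j"
proof -
  let ?p = "[:1, 1:] ^ (N - j) * [:1, - 1:] ^ j :: int poly"
  have "degree ?p = N"
    using assms by (simp add: degree_mult_eq degree_power_eq)
  then have "Phi N (N - n) j = coeff (reflect_poly ?p) n"
    using assms by (simp add: Phi_def coeff_reflect_poly)
  also have "reflect_poly ?p = [:1, 1:] ^ (N - j) * (smult (- 1) [:1, - 1:]) ^ j"
    by (simp add: reflect_poly_mult reflect_poly_power reflect_poly_pCons)
  also have "\<dots> = smult ((- 1) ^ j) ?p"
    by (simp only: smult_power mult_smult_right)
  finally show ?thesis
    by (simp add: Phi_def)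
qed

lemma pcompose_power: "pcompose (p ^ n) q = pcompose p q ^ n"
  for p q :: "'a::comm_semiring_1 poly"
  by (induction n) (simp_all add: pcompose_mult pcompose_1)

text \<open>Replacing z by -z exchanges the two factors, hence the exponents \<open>j\<close> and
  \<open>N - j\<close>, and scales the coefficient of z^n by (-1)^n.\<close>

lemma Phi_reflect_column:
  assumes "j \<le> N"
  shows "Phi N n (N - j) = (- 1) ^ n * Phi N n j"
proof -
  let ?p = "[:1, 1:] ^ (N - j) * [:1, - 1:] ^ j :: int poly"
  have "[:1, 1:] ^ (N - (N - j)) * [:1, - 1:] ^ (N - j) = pcompose ?p [:0, - 1:]"
    using assms by (simp add: pcompose_mult pcompose_power pcompose_pCons mult.commute)
  then show ?thesis
    by (simp add: Phi_def coeff_pcompose_linear)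
qed

lemma catalan_eq_diff_binomial:
  "catalan m = real ((2 * m) choose m) - real ((2 * m) choose Suc m)"
proof -
  \<comment> \<open>Both sides equal \<open>2 * m * ((2 * m - 1) choose m)\<close>.\<close>
  have "Suc m * ((2 * m) choose Suc m) = m * ((2 * m) choose m)"
    using binomial_absorb_comp[of "2 * m" m] binomial_absorption[of m "2 * m"]
    by (simp only: mult_2 add_diff_cancel_right')
  then have "real (Suc m) * real ((2 * m) choose Suc m) = real m * real ((2 * m) choose m)"
    by (simp only: of_nat_mult[symmetric])
  then show ?thesis
    by (simp add: catalan_def field_simps)
qed

lemma Phi_odd_1:
  "real_of_int (Phi (2 * m + 1) (m + 1) 1) = - catalan m"
  "real_of_int (Phi (2 * m + 1) m 1) = catalan m"
proof -
  show *: "real_of_int (Phi (2 * m + 1) (m + 1) 1) = - catalan m"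
    using Phi_Suc_Suc[of "2 * m" m 0] by (simp add: Phi_0_right catalan_eq_diff_binomial)
  show "real_of_int (Phi (2 * m + 1) m 1) = catalan m"
    \<comment> \<open>Rows \<open>m\<close> and \<open>m + 1\<close> are mirror images for
      \<open>N = 2 * m + 1\<close>, and the odd column flips the sign.\<close>
    using Phi_reflect_row[of "m + 1" "2 * m + 1" 1] * by simp
qed

text \<open>Row \<open>m\<close> is its own mirror image and column 1 is odd, so the entry equals
  its negative.\<close>

lemma Phi_even_1_middle:
  assumes "m \<ge> 1"
  shows "Phi (2 * m) m 1 = 0"
  using Phi_reflect_row[of m "2 * m" 1] assms by simp

lemma Phi_even_1:
  assumes "m \<ge> 1"
  shows "real_of_int (Phi (2 * m) (m + 1) 1) = - catalan m"
    and "real_of_int (Phi (2 * m) (m - 1) 1) = catalan m"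
proof -
  show *: "real_of_int (Phi (2 * m) (m + 1) 1) = - catalan m"
    \<comment> \<open>The recurrence is read backwards: the odd-order entry is this one plus the
      vanishing middle entry.\<close>
    using Phi_Suc[of 1 "2 * m" m] Phi_odd_1(1)[of m] Phi_even_1_middle[OF assms] assms by simp
  have "2 * m - (m + 1) = m - 1"
    by simp
  then show "real_of_int (Phi (2 * m) (m - 1) 1) = catalan m"
    using Phi_reflect_row[of "m + 1" "2 * m" 1] * assms by simp
qed

lemma Phi_even_2:
  assumes "m \<ge> 1"
  shows "real_of_int (Phi (2 * m) m 2) = - 2 * catalan (m - 1)"
proof -
  obtain k where m: "m = Suc k"
    using assms by (cases m) auto
  \<comment> \<open>The two central entries of order \<open>2 * k + 1\<close> are opposite, so their
    difference doubles; this is where the factor 2 and the index \<open>m - 1\<close> come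
    from.\<close>
  have "Phi (2 * m) m 2 = Phi (2 * k + 1) (k + 1) 1 - Phi (2 * k + 1) k 1"
    using Phi_Suc_Suc[of "2 * k + 1" k 1] by (simp add: m numeral_2_eq_2)
  then show ?thesis
    using Phi_odd_1[of k] by (simp add: m)
qed

lemma Phi_odd_2:
  assumes "m \<ge> 1"
  shows "real_of_int (Phi (2 * m + 1) (m + 1) 2) = - catalan m"
    and "real_of_int (Phi (2 * m + 1) m 2) = - catalan m"
proof -
  show *: "real_of_int (Phi (2 * m + 1) (m + 1) 2) = - catalan m"
    using Phi_Suc_Suc[of "2 * m" m 1] Phi_even_1(1)[OF assms] Phi_even_1_middle[OF assms]
    by (simp add: numeral_2_eq_2)
  show "real_of_int (Phi (2 * m + 1) m 2) = - catalan m"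
    \<comment> \<open>Column 2 is even, so here the mirror image keeps its sign.\<close>
    using Phi_reflect_row[of "m + 1" "2 * m + 1" 2] * assms by simp
qed

theorem proposition4p5:
  fixes m :: nat
  assumes "m \<ge> 1"
  shows
    "(real_of_int (Phi (2*m) (m - 1) 1) = catalan m \<and>
      real_of_int (Phi (2*m) (m + 1) 1) = - catalan m \<and>
      real_of_int (Phi (2*m) m 2) = - 2 * catalan (m - 1)) \<and>
     (real_of_int (Phi (2*m + 1) m 1) = catalan m \<and>
      real_of_int (Phi (2*m + 1) m 2) = - catalan m \<and>
      real_of_int (Phi (2*m + 1) (m + 1) 1) = - catalan m \<and>
      real_of_int (Phi (2*m + 1) (m + 1) 2) = - catalan m) \<and>
     (\<forall>N i j. i \<le> N \<longrightarrow> j \<le> N \<longrightarrow> Phi N i (N - j) = (- 1) ^ i * Phi N i j) \<and>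
     (real_of_int (Phi (2*m) (m - 1) (2*m - 1)) = (- 1) ^ (m - 1) * catalan m \<and>
      real_of_int (Phi (2*m) (m + 1) (2*m - 1)) = (- 1) ^ m * catalan m \<and>
      real_of_int (Phi (2*m) m (2*m - 2)) = (- 1) ^ (m + 1) * (2 * catalan (m - 1)) \<and>
      real_of_int (Phi (2*m + 1) m (2*m)) = (- 1) ^ m * catalan m \<and>
      real_of_int (Phi (2*m + 1) m (2*m - 1)) = (- 1) ^ (m + 1) * catalan m \<and>
      real_of_int (Phi (2*m + 1) (m + 1) (2*m)) = (- 1) ^ m * catalan m \<and>
      real_of_int (Phi (2*m + 1) (m + 1) (2*m - 1)) = (- 1) ^ m * catalan m)"
proof -
  note col_even = Phi_reflect_column[of _ "2 * m"] and col_odd = Phi_reflect_column[of _ "2 * m + 1"]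
  have "real_of_int (Phi (2 * m) (m - 1) (2 * m - 1)) = (- 1) ^ (m - 1) * catalan m"
    "real_of_int (Phi (2 * m) (m + 1) (2 * m - 1)) = (- 1) ^ m * catalan m"
    "real_of_int (Phi (2 * m) m (2 * m - 2)) = (- 1) ^ (m + 1) * (2 * catalan (m - 1))"
    \<comment> \<open>Where the value on the left is negative, its sign is absorbed into the power
      of -1, shifting the exponent by one.\<close>
    using col_even[of 1 "m - 1"] col_even[of 1 "m + 1"] col_even[of 2 m] assms
      Phi_even_1[OF assms] Phi_even_2[OF assms] by simp_all
  moreover have "real_of_int (Phi (2 * m + 1) m (2 * m)) = (- 1) ^ m * catalan m"
    "real_of_int (Phi (2 * m + 1) m (2 * m - 1)) = (- 1) ^ (m + 1) * catalan m"
    "real_of_int (Phi (2 * m + 1) (m + 1) (2 * m)) = (- 1) ^ m * catalan m"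
    "real_of_int (Phi (2 * m + 1) (m + 1) (2 * m - 1)) = (- 1) ^ m * catalan m"
    using col_odd[of 1 m] col_odd[of 2 m] col_odd[of 1 "m + 1"] col_odd[of 2 "m + 1"] assms
      Phi_odd_1[of m] Phi_odd_2[OF assms] by simp_all
  ultimately show ?thesis
    using Phi_even_1[OF assms] Phi_even_2[OF assms] Phi_odd_1[of m] Phi_odd_2[OF assms]
      Phi_reflect_column by blast
qed

end
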